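(* Let $R$ be a finite commutative local principal ring. Then for all $a,b\in R$ the matrix $M(a,b)=\begin{pmatrix}a&b\\0&0\end{pmatrix}\in M_2(R)$ is both an IN-matrix and an NI-matrix. Moreover, it admits both a nontrivial IN-factorization and a nontrivial NI-factorization.
   Context: Rings are with identity; a principal ring is one in which every ideal is principal. $M_2(R)$ is the ring of $2\times 2$ matrices over $R$. A matrix $A\in M_2(R)$ is an IN-matrix if $A=EN$ for some idempotent $E\in M_2(R)$ and some nilpotent $N\in M_2(R)$ (such an expression is an IN-factorization of $A$); it is an NI-matrix if $A=NE$ for some nilpotent $N\in M_2(R)$ and some idempotent $E\in M_2(R)$ (an NI-factorization of $A$). An IN-factorization $A=EN$, respectively an NI-factorization $A=NE$, is nontrivial if $E$ is a nontrivial idempotent (that is, $E\neq 0$ and $E\neq I$) and $N\neq 0$. *)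

theory Defs
  imports "HOL-Analysis.Analysis"
begin

text \<open>A commutative ring as a module over itself: its submodules (\<open>self_module.subspace\<close>)
  are its ideals, and \<open>self_module.span {a}\<close> is the principal ideal generated by \<open>a\<close>.\<close>

global_interpretation self_module: module "(*) :: 'a::comm_ring_1 \<Rightarrow> 'a \<Rightarrow> 'a"
  by unfold_locales (simp_all add: algebra_simps)

definition ring_ideal :: "'a::comm_ring_1 set \<Rightarrow> bool" where
  "ring_ideal I \<longleftrightarrow> self_module.subspace I"

definition principal_ideal :: "'a::comm_ring_1 set \<Rightarrow> bool" where
  "principal_ideal I \<longleftrightarrow> (\<exists>a. I = self_module.span {a})"

definition maximal_ideal :: "'a::comm_ring_1 set \<Rightarrow> bool" where
  "maximal_ideal M \<longleftrightarrow> ring_ideal M \<and> M \<noteq> UNIV \<and>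
     (\<forall>J. ring_ideal J \<longrightarrow> M \<subseteq> J \<longrightarrow> J = M \<or> J = UNIV)"

definition local_ring :: "'a::comm_ring_1 itself \<Rightarrow> bool" where
  "local_ring _ \<longleftrightarrow> (\<exists>!M :: 'a set. maximal_ideal M)"

definition principal_ring :: "'a::comm_ring_1 itself \<Rightarrow> bool" where
  "principal_ring _ \<longleftrightarrow> (\<forall>I :: 'a set. ring_ideal I \<longrightarrow> principal_ideal I)"

definition idempotent_matrix :: "'a::comm_ring_1 ^ 2 ^ 2 \<Rightarrow> bool" where
  "idempotent_matrix E \<longleftrightarrow> E ** E = E"

text \<open>Powers with respect to the matrix product \<open>**\<close>, not the componentwise product \<open>*\<close>.\<close>

definition matrix_power :: "'a::comm_ring_1 ^ 2 ^ 2 \<Rightarrow> nat \<Rightarrow> 'a ^ 2 ^ 2" where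
  "matrix_power A k = (((**) A) ^^ k) (mat 1)"

definition nilpotent_matrix :: "'a::comm_ring_1 ^ 2 ^ 2 \<Rightarrow> bool" where
  "nilpotent_matrix N \<longleftrightarrow> (\<exists>k>0. matrix_power N k = 0)"

definition IN_factorization ::
    "'a::comm_ring_1 ^ 2 ^ 2 \<Rightarrow> 'a ^ 2 ^ 2 \<Rightarrow> 'a ^ 2 ^ 2 \<Rightarrow> bool" where
  "IN_factorization A E N \<longleftrightarrow> idempotent_matrix E \<and> nilpotent_matrix N \<and> A = E ** N"

definition NI_factorization ::
    "'a::comm_ring_1 ^ 2 ^ 2 \<Rightarrow> 'a ^ 2 ^ 2 \<Rightarrow> 'a ^ 2 ^ 2 \<Rightarrow> bool" where
  "NI_factorization A N E \<longleftrightarrow> nilpotent_matrix N \<and> idempotent_matrix E \<and> A = N ** E"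

definition IN_matrix :: "'a::comm_ring_1 ^ 2 ^ 2 \<Rightarrow> bool" where
  "IN_matrix A \<longleftrightarrow> (\<exists>E N. IN_factorization A E N)"

definition NI_matrix :: "'a::comm_ring_1 ^ 2 ^ 2 \<Rightarrow> bool" where
  "NI_matrix A \<longleftrightarrow> (\<exists>N E. NI_factorization A N E)"

definition nontrivial_IN_factorization ::
    "'a::comm_ring_1 ^ 2 ^ 2 \<Rightarrow> 'a ^ 2 ^ 2 \<Rightarrow> 'a ^ 2 ^ 2 \<Rightarrow> bool" where
  "nontrivial_IN_factorization A E N \<longleftrightarrow>
     IN_factorization A E N \<and> E \<noteq> 0 \<and> E \<noteq> mat 1 \<and> N \<noteq> 0"

definition nontrivial_NI_factorization ::
    "'a::comm_ring_1 ^ 2 ^ 2 \<Rightarrow> 'a ^ 2 ^ 2 \<Rightarrow> 'a ^ 2 ^ 2 \<Rightarrow> bool" where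
  "nontrivial_NI_factorization A N E \<longleftrightarrow>
     NI_factorization A N E \<and> E \<noteq> 0 \<and> E \<noteq> mat 1 \<and> N \<noteq> 0"

definition top_row_matrix :: "'a::comm_ring_1 \<Rightarrow> 'a \<Rightarrow> 'a ^ 2 ^ 2" where
  "top_row_matrix a b = vector [vector [a, b], vector [0, 0]]"

end

theory Submission
  imports Defs
begin

text \<open>In a finite local ring every non-unit is nilpotent. For the IN-factorization of \<open>M(a,b) \<noteq> 0\<close>:
  if \<open>a\<close> is nilpotent, then \<open>M(a,b)\<close> is itself nilpotent and is fixed by \<open>E\<^sub>1\<^sub>1\<close> from the left;
  if \<open>a\<close> is a unit, let \<open>E\<close> have rows \<open>(1, x)\<close> and \<open>(0, 0)\<close>. Then \<open>E N = M(a,b)\<close> with \<open>N\<close> of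
  trace and determinant zero can be solved for \<open>N\<close> as soon as \<open>a x - b\<close> is a unit, and
  \<open>x = (b + 1)/a\<close> makes it \<open>1\<close>. The NI-factorization needs that divisibility in a local principal
  ring is total: if \<open>b dvd a\<close>, or if \<open>a\<close> is a unit, then \<open>N\<close> can be taken strictly upper
  triangular; otherwise \<open>b = a t\<close> with \<open>a\<close> nilpotent, and \<open>N = a E\<^sub>1\<^sub>1\<close> works.\<close>

section \<open>Units, nilpotents and divisibility in finite local principal rings\<close>

lemma ring_ideal_mult:
  assumes "ring_ideal I" "x \<in> I"
  shows "c * x \<in> I"
  using assms self_module.subspace_scale unfolding ring_ideal_def by blast

lemma ring_ideal_add:
  assumes "ring_ideal I" "x \<in> I" "y \<in> I"
  shows "x + y \<in> I"
  using assms self_module.subspace_add unfolding ring_ideal_def by blast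

lemma ring_ideal_UNIV_iff:
  assumes "ring_ideal I"
  shows "I = UNIV \<longleftrightarrow> 1 \<in> I"
  using ring_ideal_mult[OF assms, of 1] by auto

text \<open>A finite ring has only finitely many ideals, so a maximal one among the proper ideals
  above \<open>I\<close> exists without Zorn's lemma.\<close>

lemma proper_ideal_subset_maximal_ideal:
  fixes I :: "'a::comm_ring_1 set"
  assumes fin: "finite (UNIV :: 'a set)" and I: "ring_ideal I" "I \<noteq> UNIV"
  obtains M where "maximal_ideal M" "I \<subseteq> M"
proof -
  let ?A = "{J :: 'a set. ring_ideal J \<and> J \<noteq> UNIV}"
  have "finite ?A"
    using finite_subset[of ?A "Pow UNIV"] fin finite_Pow_iff by blast
  then obtain M where "M \<in> ?A" "I \<subseteq> M" "\<forall>J\<in>?A. M \<subseteq> J \<longrightarrow> M = J"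
    using finite_has_maximal2[of ?A I] I by auto
  then show thesis
    by (intro that[of M]) (auto simp: maximal_ideal_def)
qed

text \<open>Every non-unit generates a proper ideal and so lies in the unique maximal ideal
  \<open>M\<close>; a sum of two non-units stays in \<open>M\<close>, which contains no
  unit.\<close>

lemma local_ring_add_unit:
  fixes x y :: "'a::comm_ring_1"
  assumes fin: "finite (UNIV :: 'a set)" and loc: "local_ring TYPE('a)"
    and unit: "x + y dvd 1"
  shows "x dvd 1 \<or> y dvd 1"
proof (rule ccontr)
  assume *: "\<not> ?thesis"
  obtain M :: "'a set" where M: "maximal_ideal M" "\<And>M'. maximal_ideal M' \<Longrightarrow> M' = M"
    using loc unfolding local_ring_def by blast
  have nonunit: "z \<in> M" if "\<not> z dvd 1" for z
  proof -
    have id: "ring_ideal (self_module.span {z})"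
      by (simp add: ring_ideal_def)
    have "1 \<notin> self_module.span {z}"
      using that by (auto simp: self_module.span_singleton dvd_def mult.commute)
    then obtain M' where "maximal_ideal M'" "self_module.span {z} \<subseteq> M'"
      using proper_ideal_subset_maximal_ideal[OF fin id] ring_ideal_UNIV_iff[OF id] by blast
    then show ?thesis
      using M(2) self_module.span_base[of z "{z}"] by blast
  qed
  have idM: "ring_ideal M" and prM: "1 \<notin> M"
    using M(1) ring_ideal_UNIV_iff unfolding maximal_ideal_def by blast+
  have "x + y \<in> M"
    using * nonunit ring_ideal_add[OF idM] by blast
  moreover obtain c where "1 = c * (x + y)"
    using unit by (auto simp: dvd_def mult.commute)
  ultimately show False
    using prM ring_ideal_mult[OF idM] by metis
qed

text \<open>By finiteness two powers of \<open>x\<close> agree, which gives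
  \<open>x ^ i * (1 - x ^ d) = 0\<close>; locality makes the second factor a unit.\<close>

lemma local_ring_nonunit_nilpotent:
  fixes x :: "'a::comm_ring_1"
  assumes fin: "finite (UNIV :: 'a set)" and loc: "local_ring TYPE('a)"
    and x: "\<not> x dvd 1"
  obtains k where "x ^ k = 0"
proof -
  have "\<not> inj (\<lambda>n. x ^ n)"
    using finite_imageD[of "\<lambda>n. x ^ n" UNIV] finite_subset[OF subset_UNIV fin] by auto
  then obtain i j where ij: "i < j" "x ^ i = x ^ j"
    unfolding inj_def by (metis linorder_neqE_nat)
  define d where "d = j - i"
  \<comment> \<open>Here \<open>d > 0\<close> matters: it keeps \<open>x ^ d\<close> a
    non-unit.\<close>
  have "x dvd x ^ d"
    using ij(1) by (intro dvd_power) (simp add: d_def)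
  then have "\<not> x ^ d dvd 1"
    using x dvd_trans by blast
  then have "1 - x ^ d dvd 1"
    using local_ring_add_unit[OF fin loc, of "1 - x ^ d" "x ^ d"] by simp
  then obtain u where u: "(1 - x ^ d) * u = 1"
    by (metis dvd_def)
  have "x ^ i * x ^ d = x ^ j"
    using ij(1) by (simp add: d_def flip: power_add)
  with ij(2) have "x ^ i * (1 - x ^ d) = 0"
    by (simp add: right_diff_distrib)
  then have "x ^ i = 0"
    by (metis u mult.assoc mult.right_neutral mult_zero_left)
  then show thesis by (rule that)
qed

text \<open>Let \<open>g\<close> generate the ideal of \<open>a\<close> and \<open>b\<close>. Among
  \<open>x * a'\<close>, \<open>y * b'\<close> and \<open>1 - (x * a' + y * b')\<close>, which sum
  to 1, one is a unit. Accordingly \<open>a\<close> divides \<open>g\<close>, \<open>b\<close>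
  divides \<open>g\<close>, or \<open>g = 0\<close>.\<close>

lemma local_principal_ring_dvd_total:
  fixes a b :: "'a::comm_ring_1"
  assumes fin: "finite (UNIV :: 'a set)" and loc: "local_ring TYPE('a)"
    and pri: "principal_ring TYPE('a)"
  shows "a dvd b \<or> b dvd a"
proof -
  obtain g where g: "self_module.span {a, b} = self_module.span {g}"
    using pri unfolding principal_ring_def principal_ideal_def ring_ideal_def
    by (meson self_module.subspace_span)
  have mem: "a \<in> self_module.span {g}" "b \<in> self_module.span {g}" "g \<in> self_module.span {a, b}"
    using self_module.span_base[of _ "{a, b}"] self_module.span_base[of g "{g}"] g by auto
  obtain a' b' where ab: "a = a' * g" "b = b' * g"
    using mem(1,2) by (auto simp: self_module.span_singleton)
  obtain x y where xy: "g = x * a + y * b"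
    using mem(3) by (auto simp: self_module.span_insert self_module.span_singleton algebra_simps)
  have "g = x * (a' * g) + y * (b' * g)"
    using xy unfolding ab .
  then have "g * (x * a' + y * b') = g"
    by (metis distrib_right mult.assoc mult.commute)
  then have eq: "g * (1 - (x * a' + y * b')) = 0"
    by (simp only: right_diff_distrib) simp
  have "x * a' + y * b' dvd 1 \<or> 1 - (x * a' + y * b') dvd 1"
    using local_ring_add_unit[OF fin loc, of "x * a' + y * b'" "1 - (x * a' + y * b')"] by simp
  then consider "x * a' dvd 1" | "y * b' dvd 1" | "1 - (x * a' + y * b') dvd 1"
    using local_ring_add_unit[OF fin loc] by blast
  then show ?thesis
  proof cases
    case 1
    then have "a' dvd 1" using dvd_mult_right by blast
    then have "a dvd g" using mult_dvd_mono[of a' 1 g g] ab by simp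
    then show ?thesis using ab by auto
  next
    case 2
    then have "b' dvd 1" using dvd_mult_right by blast
    then have "b dvd g" using mult_dvd_mono[of b' 1 g g] ab by simp
    then show ?thesis using ab by auto
  next
    case 3
    then obtain u where "(1 - (x * a' + y * b')) * u = 1" by (metis dvd_def)
    then have "g = 0" by (metis eq mult.assoc mult.right_neutral mult_zero_left)
    then show ?thesis using ab by simp
  qed
qed

section \<open>Idempotent and nilpotent 2 by 2 matrices\<close>

definition mat2 :: "'a::comm_ring_1 \<Rightarrow> 'a \<Rightarrow> 'a \<Rightarrow> 'a \<Rightarrow> 'a ^ 2 ^ 2" where
  "mat2 a b c d = vector [vector [a, b], vector [c, d]]"

lemma mat2_mult:
  "mat2 a b c d ** mat2 a' b' c' d' =
    mat2 (a * a' + b * c') (a * b' + b * d') (c * a' + d * c') (c * b' + d * d')"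
  by (simp add: mat2_def vec_eq_iff forall_2 matrix_matrix_mult_def sum_2)

lemma mat2_eq_iff: "mat2 a b c d = mat2 a' b' c' d' \<longleftrightarrow> a = a' \<and> b = b' \<and> c = c' \<and> d = d'"
  by (auto simp: mat2_def vec_eq_iff forall_2)

lemma zero_eq_mat2: "0 = mat2 0 0 0 0"
  by (simp add: mat2_def vec_eq_iff forall_2)

lemma mat_1_eq_mat2: "mat 1 = mat2 1 0 0 1"
  by (simp add: mat2_def vec_eq_iff forall_2 mat_def)

lemma top_row_matrix_eq_mat2: "top_row_matrix a b = mat2 a b 0 0"
  by (simp add: top_row_matrix_def mat2_def)

lemmas mat2_simps = mat2_mult mat2_eq_iff zero_eq_mat2 mat_1_eq_mat2 top_row_matrix_eq_mat2

text \<open>The matrix has trace 1, and the assumption says that its determinant is 0; by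
  Cayley-Hamilton it equals its square.\<close>

lemma idempotent_mat2:
  assumes "b * c = (1 - d) * d"
  shows "idempotent_matrix (mat2 (1 - d) b c d)"
proof -
  have "(1 - d) * (1 - d) + b * c = 1 - d" "c * b + d * d = d"
    unfolding mult.commute[of c b] assms by (simp_all add: algebra_simps)
  moreover have "(1 - d) * b + b * d = b" "c * (1 - d) + d * c = c"
    by (simp_all add: algebra_simps)
  ultimately show ?thesis
    by (simp only: idempotent_matrix_def mat2_mult)
qed

lemma nilpotent_matrix_square_zero:
  assumes "N ** N = 0"
  shows "nilpotent_matrix N"
  unfolding nilpotent_matrix_def matrix_power_def
  using assms by (intro exI[of _ 2]) (simp add: numeral_2_eq_2)

text \<open>The exponent starts at \<open>Suc 0\<close> because the zeroth power, the identity, does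
  not have a zero bottom row.\<close>

lemma matrix_power_top_row:
  "matrix_power (mat2 a b 0 0) (Suc k) = mat2 (a ^ Suc k) (a ^ k * b) 0 0"
proof (induction k)
  case 0
  show ?case
    unfolding matrix_power_def by simp
next
  case (Suc k)
  have "matrix_power (mat2 a b 0 0) (Suc (Suc k)) =
      mat2 a b 0 0 ** matrix_power (mat2 a b 0 0) (Suc k)"
    unfolding matrix_power_def by (simp only: funpow.simps o_apply)
  then show ?case
    by (simp only: Suc.IH mat2_mult power_Suc mult.assoc mult_zero_left mult_zero_right add_0_right)
qed

lemma nilpotent_top_row:
  assumes "a ^ k = 0"
  shows "nilpotent_matrix (mat2 a b 0 0)"
  unfolding nilpotent_matrix_def
  by (intro exI[of _ "Suc k"]) (simp add: matrix_power_top_row assms zero_eq_mat2)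

section \<open>Explicit nontrivial factorizations\<close>

lemma top_row_nontrivial_IN_factorization:
  fixes a b :: "'a::comm_ring_1"
  assumes "a dvd 1 \<or> (\<exists>k. a ^ k = 0)"
  shows "\<exists>E N. nontrivial_IN_factorization (top_row_matrix a b) E N"
proof -
  consider "a = 0" "b = 0" | "a \<noteq> 0 \<or> b \<noteq> 0" "\<exists>k. a ^ k = 0" | "a dvd 1"
    using assms by blast
  then show ?thesis
  proof cases
    case 1
    \<comment> \<open>The zero matrix needs a nonzero nilpotent whose top row vanishes.\<close>
    have "nontrivial_IN_factorization (top_row_matrix a b) (mat2 1 0 0 0) (mat2 0 0 1 0)"
      unfolding nontrivial_IN_factorization_def IN_factorization_def idempotent_matrix_def
      using 1 by (auto simp: mat2_simps intro!: nilpotent_matrix_square_zero)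
    then show ?thesis by blast
  next
    case 2
    then have "nontrivial_IN_factorization (top_row_matrix a b) (mat2 1 0 0 0) (mat2 a b 0 0)"
      unfolding nontrivial_IN_factorization_def IN_factorization_def idempotent_matrix_def
      by (auto simp: mat2_simps intro: nilpotent_top_row)
    then show ?thesis by blast
  next
    case 3
    then obtain i where i: "a * i = 1" by (metis dvd_def)
    \<comment> \<open>\<open>?N\<close> is the column \<open>(-b, a)\<close> times the row
      \<open>(a, b)\<close>. It squares to zero since this row kills this column, and the top row of
      \<open>?E\<close> sends the column to 1.\<close>
    let ?E = "mat2 1 ((b + 1) * i) 0 0" and ?N = "mat2 (- (a * b)) (- (b * b)) (a * a) (a * b)"
    have inv: "i * (a * c) = c" for c
      using i by (metis mult.assoc mult.commute mult_1)
    then have cancel: "(b + 1) * i * (a * c) = (b + 1) * c" for c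
      by (simp only: mult.assoc)
    have "?E ** ?N = top_row_matrix a b"
      unfolding mat2_mult cancel top_row_matrix_eq_mat2 mat2_eq_iff by (simp add: algebra_simps)
    moreover have "nilpotent_matrix ?N"
      by (rule nilpotent_matrix_square_zero) (simp add: mat2_mult zero_eq_mat2 mat2_eq_iff)
    moreover have "a * a \<noteq> 0"
    proof
      assume "a * a = 0"
      then have "a = 0" using inv[of a] by (simp only: mult_zero_right)
      then show False using i by simp
    qed
    ultimately have "nontrivial_IN_factorization (top_row_matrix a b) ?E ?N"
      unfolding nontrivial_IN_factorization_def IN_factorization_def idempotent_matrix_def
      by (simp add: mat2_simps)
    then show ?thesis by blast
  qed
qed

lemma top_row_nontrivial_NI_factorization:
  fixes a b :: "'a::comm_ring_1"
  assumes "a dvd 1 \<or> (\<exists>k. a ^ k = 0)" and "a dvd b \<or> b dvd a"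
  shows "\<exists>N E. nontrivial_NI_factorization (top_row_matrix a b) N E"
proof -
  \<comment> \<open>The inequalities keep the nilpotent factors \<open>mat2 0 b 0 0\<close> and
    \<open>mat2 a 0 0 0\<close> nonzero.\<close>
  consider "a = 0" "b = 0" | "a dvd 1" | "b \<noteq> 0" "b dvd a" | "a \<noteq> 0" "a dvd b" "\<exists>k. a ^ k = 0"
    using assms by fastforce
  then show ?thesis
  proof cases
    case 1
    have "nontrivial_NI_factorization (top_row_matrix a b) (mat2 0 1 0 0) (mat2 1 0 0 0)"
      unfolding nontrivial_NI_factorization_def NI_factorization_def idempotent_matrix_def
      using 1 by (auto simp: mat2_simps intro!: nilpotent_matrix_square_zero)
    then show ?thesis by blast
  next
    case 2
    then obtain i where i: "a * i = 1" by (metis dvd_def)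
    \<comment> \<open>Left multiplication by \<open>?N\<close> moves the bottom row to the top, so
      \<open>?E\<close> gets bottom row \<open>(a, b)\<close>; trace 1 and determinant 0 then
      determine its top row.\<close>
    let ?N = "mat2 0 1 0 0" and ?E = "mat2 (1 - b) ((1 - b) * b * i) a b"
    have "(1 - b) * b * i * a = (1 - b) * b"
      using i by (metis mult.assoc mult.commute mult_1)
    then have "idempotent_matrix ?E"
      by (rule idempotent_mat2)
    moreover have "nilpotent_matrix ?N"
      by (rule nilpotent_matrix_square_zero) (simp add: mat2_simps)
    moreover have "a \<noteq> 0" using i by auto
    ultimately have "nontrivial_NI_factorization (top_row_matrix a b) ?N ?E"
      unfolding nontrivial_NI_factorization_def NI_factorization_def
      by (simp add: mat2_simps)
    then show ?thesis by blast
  next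
    case 3
    then obtain t where t: "a = b * t" by (auto simp: dvd_def)
    have "nontrivial_NI_factorization (top_row_matrix a b) (mat2 0 b 0 0) (mat2 0 0 t 1)"
      unfolding nontrivial_NI_factorization_def NI_factorization_def idempotent_matrix_def
      using 3 t by (auto simp: mat2_simps intro!: nilpotent_matrix_square_zero)
    then show ?thesis by blast
  next
    case 4
    then obtain t where t: "b = a * t" by (auto simp: dvd_def)
    have "nontrivial_NI_factorization (top_row_matrix a b) (mat2 a 0 0 0) (mat2 1 t 0 0)"
      unfolding nontrivial_NI_factorization_def NI_factorization_def idempotent_matrix_def
      using 4 t by (auto simp: mat2_simps intro: nilpotent_top_row)
    then show ?thesis by blast
  qed
qed

theorem lemma3p4:
  fixes a b :: "'a :: comm_ring_1"
  assumes "finite (UNIV :: 'a set)"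
    and "local_ring TYPE('a)"
    and "principal_ring TYPE('a)"
  shows "IN_matrix (top_row_matrix a b) \<and> NI_matrix (top_row_matrix a b) \<and>
    (\<exists>E N. nontrivial_IN_factorization (top_row_matrix a b) E N) \<and>
    (\<exists>N E. nontrivial_NI_factorization (top_row_matrix a b) N E)"
proof -
  have a: "a dvd 1 \<or> (\<exists>k. a ^ k = 0)"
    using local_ring_nonunit_nilpotent[OF assms(1,2)] by metis
  show ?thesis
    using top_row_nontrivial_IN_factorization[OF a, of b]
      top_row_nontrivial_NI_factorization[OF a local_principal_ring_dvd_total[OF assms]]
    unfolding IN_matrix_def NI_matrix_def nontrivial_IN_factorization_def
      nontrivial_NI_factorization_def by blast
qed

end
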